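(* Let $G$ be a connected graph and let $S \subseteq V(G)$. Let $H$ be the minimum flower subgraph of $G$ whose vertex set contains $\langle S \rangle$. Then $S$ is monophonically convexly independent if and only if for every mp-subgraph $M$ of $H$ the following holds: if $M$ is a petal mp-subgraph of $H$, then $S \cap V(M)$ is contained in a stamen set for $M$ in $H$; otherwise $S \cap V(M) = \varnothing$.
   Context: All graphs are finite, simple and undirected. Monophonic convexity: a set $S \subseteq V(G)$ is monophonically convex if every vertex of every induced path joining two vertices of $S$ lies in $S$; the monophonic convex hull $\langle S \rangle$ is the smallest monophonically convex set containing $S$. $S$ is monophonically convexly independent if $v \notin \langle S - \{v\} \rangle$ for every $v \in S$. A clique separator of a connected graph is a clique whose removal disconnects the graph. A connected graph is prime if it has no clique separator. A maximal prime subgraph (mp-subgraph) of $G$ is a maximal induced subgraph of $G$ that is prime. For an mp-subgraph $M$ of $G$, $\partial M$ denotes the set of vertices of $M$ that belong to some other mp-subgraph of $G$, and $M^\circ = V(M) - \partial M$. $M$ is a petal mp-subgraph of $G$ if $M^\circ \neq \varnothing$ and $\partial M$ is a clique (possibly empty). A flower subgraph of $G$ is defined recursively: $G$ is a flower subgraph of $G$, and if $G'$ is a flower subgraph of $G$ and $M$ is a petal mp-subgraph of $G'$, then $G' - M^\circ$ is a flower subgraph of $G$. For a petal mp-subgraph $M$ of a graph $G$, a set $X \subseteq M^\circ$ is a stamen set for $M$ in $G$ if either (Type 1) $|X| = 1$; or (Type 2) $X = \{u_1,u_2\}$ and every vertex of $\partial M$ is adjacent to both $u_1$ and $u_2$;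 or (Type 3) $|X| \ge 2$ and $X \cup \partial M$ is a clique. *)

theory Defs
  imports Main "HOL.Hull"
begin

text \<open>
  A graph is a finite vertex set \<open>V\<close> with a symmetric, irreflexive adjacency relation \<open>E\<close>.
  Every subgraph considered below is an induced subgraph, so it is identified with its vertex set
  \<open>U \<subseteq> V\<close>; a notion applied to \<open>U\<close> and \<open>E\<close> refers to the subgraph induced by \<open>U\<close> and uses
  \<open>E\<close> only between vertices of \<open>U\<close>.
\<close>

definition simple_graph :: "'a set \<Rightarrow> ('a \<Rightarrow> 'a \<Rightarrow> bool) \<Rightarrow> bool" where
  "simple_graph V E \<longleftrightarrow>
     finite V \<and> (\<forall>u v. E u v \<longrightarrow> u \<in> V \<and> v \<in> V) \<and> symp E \<and> irreflp E"

text \<open>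
  The empty graph counts as connected. This is needed for complete graphs to be prime (removing all
  vertices must not count as disconnecting), and the empty graph does occur as a flower subgraph.
\<close>

definition connected_graph :: "'a set \<Rightarrow> ('a \<Rightarrow> 'a \<Rightarrow> bool) \<Rightarrow> bool" where
  "connected_graph U E \<longleftrightarrow>
     (\<forall>u\<in>U. \<forall>v\<in>U. (\<lambda>x y. x \<in> U \<and> y \<in> U \<and> E x y)\<^sup>*\<^sup>* u v)"

definition clique :: "'a set \<Rightarrow> ('a \<Rightarrow> 'a \<Rightarrow> bool) \<Rightarrow> 'a set \<Rightarrow> bool" where
  "clique U E K \<longleftrightarrow> K \<subseteq> U \<and> pairwise E K"

definition induced_path :: "'a set \<Rightarrow> ('a \<Rightarrow> 'a \<Rightarrow> bool) \<Rightarrow> 'a list \<Rightarrow> bool" where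
  "induced_path U E xs \<longleftrightarrow>
     xs \<noteq> [] \<and> distinct xs \<and> set xs \<subseteq> U \<and>
     (\<forall>i j. i < j \<and> j < length xs \<longrightarrow> (E (xs ! i) (xs ! j) \<longleftrightarrow> j = Suc i))"

definition monophonic_convex :: "'a set \<Rightarrow> ('a \<Rightarrow> 'a \<Rightarrow> bool) \<Rightarrow> 'a set \<Rightarrow> bool" where
  "monophonic_convex V E C \<longleftrightarrow>
     C \<subseteq> V \<and> (\<forall>xs. induced_path V E xs \<and> hd xs \<in> C \<and> last xs \<in> C \<longrightarrow> set xs \<subseteq> C)"

definition monophonic_hull :: "'a set \<Rightarrow> ('a \<Rightarrow> 'a \<Rightarrow> bool) \<Rightarrow> 'a set \<Rightarrow> 'a set" where
  "monophonic_hull V E S = monophonic_convex V E hull S"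

definition convexly_independent :: "'a set \<Rightarrow> ('a \<Rightarrow> 'a \<Rightarrow> bool) \<Rightarrow> 'a set \<Rightarrow> bool" where
  "convexly_independent V E S \<longleftrightarrow> (\<forall>v\<in>S. v \<notin> monophonic_hull V E (S - {v}))"

definition clique_separator :: "'a set \<Rightarrow> ('a \<Rightarrow> 'a \<Rightarrow> bool) \<Rightarrow> 'a set \<Rightarrow> bool" where
  "clique_separator U E K \<longleftrightarrow> clique U E K \<and> \<not> connected_graph (U - K) E"

definition prime_graph :: "'a set \<Rightarrow> ('a \<Rightarrow> 'a \<Rightarrow> bool) \<Rightarrow> bool" where
  "prime_graph U E \<longleftrightarrow> connected_graph U E \<and> (\<nexists>K. clique_separator U E K)"

definition mp_subgraph :: "'a set \<Rightarrow> ('a \<Rightarrow> 'a \<Rightarrow> bool) \<Rightarrow> 'a set \<Rightarrow> bool" where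
  "mp_subgraph U E M \<longleftrightarrow>
     M \<subseteq> U \<and> prime_graph M E \<and> (\<forall>N. M \<subseteq> N \<and> N \<subseteq> U \<and> prime_graph N E \<longrightarrow> N = M)"

definition mp_boundary :: "'a set \<Rightarrow> ('a \<Rightarrow> 'a \<Rightarrow> bool) \<Rightarrow> 'a set \<Rightarrow> 'a set" where
  "mp_boundary U E M = {v \<in> M. \<exists>N. mp_subgraph U E N \<and> N \<noteq> M \<and> v \<in> N}"

definition mp_interior :: "'a set \<Rightarrow> ('a \<Rightarrow> 'a \<Rightarrow> bool) \<Rightarrow> 'a set \<Rightarrow> 'a set" where
  "mp_interior U E M = M - mp_boundary U E M"

definition petal :: "'a set \<Rightarrow> ('a \<Rightarrow> 'a \<Rightarrow> bool) \<Rightarrow> 'a set \<Rightarrow> bool" where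
  "petal U E M \<longleftrightarrow>
     mp_subgraph U E M \<and> mp_interior U E M \<noteq> {} \<and> clique U E (mp_boundary U E M)"

inductive flower_subgraph :: "'a set \<Rightarrow> ('a \<Rightarrow> 'a \<Rightarrow> bool) \<Rightarrow> 'a set \<Rightarrow> bool"
  for V :: "'a set" and E :: "'a \<Rightarrow> 'a \<Rightarrow> bool" where
  self: "flower_subgraph V E V"
| remove_petal: "flower_subgraph V E U \<Longrightarrow> petal U E M \<Longrightarrow> flower_subgraph V E (U - mp_interior U E M)"

text \<open>
  ``Minimum'' means with the fewest vertices. An inclusion-least flower subgraph need not exist: for
  the path \<open>a\<close>, \<open>b\<close>, \<open>c\<close> and \<open>S = {b}\<close>, both edges are flower subgraphs containing
  the hull of \<open>S\<close>, but \<open>{b}\<close> is not a flower subgraph. If an inclusion-least one exists, it is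
  the only one that is minimum in the present sense.
\<close>

definition minimum_flower :: "'a set \<Rightarrow> ('a \<Rightarrow> 'a \<Rightarrow> bool) \<Rightarrow> 'a set \<Rightarrow> 'a set \<Rightarrow> bool" where
  "minimum_flower V E S H \<longleftrightarrow>
     flower_subgraph V E H \<and> monophonic_hull V E S \<subseteq> H \<and>
     (\<forall>H'. flower_subgraph V E H' \<and> monophonic_hull V E S \<subseteq> H' \<longrightarrow> card H \<le> card H')"

definition stamen_set :: "'a set \<Rightarrow> ('a \<Rightarrow> 'a \<Rightarrow> bool) \<Rightarrow> 'a set \<Rightarrow> 'a set \<Rightarrow> bool" where
  "stamen_set U E M X \<longleftrightarrow>
     X \<subseteq> mp_interior U E M \<and>
     (card X = 1 \<or>
      (\<exists>u1 u2. X = {u1, u2} \<and> (\<forall>w \<in> mp_boundary U E M. E w u1 \<and> E w u2)) \<or>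
      (card X \<ge> 2 \<and> clique U E (X \<union> mp_boundary U E M)))"

lemma monophonic_convex_self: "monophonic_convex V E V"
  by (auto simp: monophonic_convex_def induced_path_def)

lemma monophonic_hull_subset: "S \<subseteq> V \<Longrightarrow> monophonic_hull V E S \<subseteq> V"
  unfolding monophonic_hull_def by (intro hull_minimal monophonic_convex_self)

lemma monophonic_convex_hull:
  assumes "S \<subseteq> V"
  shows "monophonic_convex V E (monophonic_hull V E S)"
  unfolding monophonic_convex_def
proof (intro conjI allI impI)
  show "monophonic_hull V E S \<subseteq> V" by (rule monophonic_hull_subset[OF assms])
next
  fix xs
  assume xs: "induced_path V E xs \<and> hd xs \<in> monophonic_hull V E S \<and> last xs \<in> monophonic_hull V E S"
  show "set xs \<subseteq> monophonic_hull V E S"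
    unfolding monophonic_hull_def hull_def
  proof (rule Inter_greatest)
    fix C assume C: "C \<in> {t. monophonic_convex V E t \<and> S \<subseteq> t}"
    then have "monophonic_hull V E S \<subseteq> C"
      unfolding monophonic_hull_def by (simp add: hull_minimal)
    then have "hd xs \<in> C" "last xs \<in> C" using xs by auto
    with C xs show "set xs \<subseteq> C" by (simp add: monophonic_convex_def)
  qed
qed

lemma ex_minimum_flower:
  assumes "S \<subseteq> V"
  shows "\<exists>H. minimum_flower V E S H"
proof -
  have "flower_subgraph V E V \<and> monophonic_hull V E S \<subseteq> V"
    using monophonic_hull_subset[OF assms] by (simp add: flower_subgraph.self)
  from ex_has_least_nat[of "\<lambda>H. flower_subgraph V E H \<and> monophonic_hull V E S \<subseteq> H", OF this, of card]
  show ?thesis unfolding minimum_flower_def by blast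
qed

end

theory Submission
  imports Defs
begin

text \<open>
  If \<open>C\<close> is convex in \<open>H\<close>, a component of \<open>H - C\<close> has a clique as its neighbourhood, since a
  shortest path through the component joins two nonadjacent attachments by an induced path. An
  inclusion-minimal region \<open>D\<close> whose neighbourhood is a clique makes up, with its neighbourhood, a
  petal with \<open>D\<close> in its interior. Hence a vertex outside \<open>C\<close> either lies in the interior of a petal
  or witnesses a petal whose interior misses \<open>C\<close>. By minimality of \<open>H\<close> every petal interior meets
  \<open>S\<close>; taking for \<open>C\<close> the hulls of \<open>S - {v}\<close> shows that an independent \<open>S\<close> lies in the petal
  interiors, and that the boundary of a petal with at least two vertices of \<open>S\<close> lies in each of
  these hulls. A convex set with two nonadjacent vertices in a prime subgraph contains the whole
  subgraph, which leaves only the stamen sets. Conversely, if \<open>X\<close> is a stamen set of the petal \<open>M\<close>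
  of \<open>H\<close> and \<open>v \<in> X\<close>, then \<open>(H - M\<degree>) \<union> (X - {v})\<close> is convex because it is attached to
  the rest of \<open>H\<close> along a clique.
\<close>

section \<open>Adjacency, components and neighbourhoods\<close>

locale adjacency =
  fixes E :: "'a \<Rightarrow> 'a \<Rightarrow> bool"
  assumes symp_E: "symp E"
begin

lemma E_sym: "E x y \<Longrightarrow> E y x"
  using symp_E by (auto dest: sympD)

abbreviation adj_in :: "'a set \<Rightarrow> 'a \<Rightarrow> 'a \<Rightarrow> bool" where
  "adj_in U \<equiv> \<lambda>x y. x \<in> U \<and> y \<in> U \<and> E x y"

text \<open>The reflexive closure puts \<open>u\<close> into its component even when
  \<open>u\<close> lies outside \<open>U\<close>, hence the assumption \<open>u \<in> U\<close> in
  the lemmas on components.\<close>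

definition component :: "'a set \<Rightarrow> 'a \<Rightarrow> 'a set" where
  "component U u = {x. (adj_in U)\<^sup>*\<^sup>* u x}"

definition nbhd :: "'a set \<Rightarrow> 'a set \<Rightarrow> 'a set" where
  "nbhd U A = {y \<in> U - A. \<exists>x\<in>A. E x y}"

lemma adj_in_sym: "(adj_in U)\<^sup>*\<^sup>* x y \<Longrightarrow> (adj_in U)\<^sup>*\<^sup>* y x"
  by (induction rule: rtranclp_induct) (auto intro: converse_rtranclp_into_rtranclp E_sym)

lemma component_self: "u \<in> component U u"
  by (simp add: component_def)

lemma component_subset:
  assumes "u \<in> U" shows "component U u \<subseteq> U"
proof
  fix x assume "x \<in> component U u"
  then have "(adj_in U)\<^sup>*\<^sup>* u x" by (simp add: component_def)
  then show "x \<in> U" by (induction rule: rtranclp_induct) (use assms in auto)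
qed

lemma component_closed:
  assumes "u \<in> U" "x \<in> component U u" "y \<in> U" "E x y"
  shows "y \<in> component U u"
  using assms component_subset[OF assms(1)]
  by (auto simp: component_def intro: rtranclp.rtrancl_into_rtrancl)

lemma nbhd_component_subset:
  assumes "u \<in> U - K" shows "nbhd U (component (U - K) u) \<subseteq> K"
  using component_closed[OF assms] by (auto simp: nbhd_def)

lemma adj_in_component:
  assumes "u \<in> U" "x \<in> component U u" "y \<in> component U u"
  shows "(adj_in (component U u))\<^sup>*\<^sup>* x y"
proof -
  have from_u: "(adj_in (component U u))\<^sup>*\<^sup>* u z" if "(adj_in U)\<^sup>*\<^sup>* u z" for z
    using that
  proof (induction rule: rtranclp_induct)
    case (step a b)
    have "a \<in> component U u" using step by (simp add: component_def)
    moreover have "b \<in> component U u" using step calculation component_closed[OF assms(1)] by blast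
    ultimately show ?case using step by (auto intro: rtranclp.rtrancl_into_rtrancl)
  qed simp
  have "(adj_in U)\<^sup>*\<^sup>* u x" "(adj_in U)\<^sup>*\<^sup>* u y"
    using assms(2,3) by (simp_all add: component_def)
  then show ?thesis by (rule rtranclp_trans[OF adj_in_sym[OF from_u] from_u])
qed

lemma nbhd_mono:
  assumes "D \<subseteq> A" "A \<subseteq> U" shows "D \<union> nbhd U D \<subseteq> A \<union> nbhd U A"
  using assms by (auto simp: nbhd_def)

section \<open>Connected and prime subgraphs\<close>

lemma connected_graph_subset:
  assumes "connected_graph U E" "U \<inter> A \<noteq> {}"
    and closed: "\<And>x y. x \<in> A \<Longrightarrow> x \<in> U \<Longrightarrow> y \<in> U \<Longrightarrow> E x y \<Longrightarrow> y \<in> A"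
  shows "U \<subseteq> A"
proof
  fix y assume "y \<in> U"
  obtain x where x: "x \<in> U" "x \<in> A" using assms by blast
  have "(adj_in U)\<^sup>*\<^sup>* x y" using assms(1) x \<open>y \<in> U\<close> by (simp add: connected_graph_def)
  then show "y \<in> A" by (induction rule: rtranclp_induct) (use x closed in auto)
qed

lemma connected_graph_pairwise:
  assumes "pairwise E K" shows "connected_graph K E"
  unfolding connected_graph_def
proof (intro ballI)
  fix u v assume "u \<in> K" "v \<in> K"
  then show "(adj_in K)\<^sup>*\<^sup>* u v"
    using assms by (cases "u = v") (auto simp: pairwise_def intro: r_into_rtranclp)
qed

lemma prime_graph_pairwise:
  assumes "pairwise E K" shows "prime_graph K E"
  using assms connected_graph_pairwise
  by (auto simp: prime_graph_def clique_separator_def pairwise_def)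

text \<open>\<open>K\<close> may stick out of \<open>N\<close>: only its trace
  \<open>N \<inter> K\<close> is removed, and that is a clique of \<open>N\<close>.\<close>

lemma prime_graph_diff_connected:
  assumes "prime_graph N E" "pairwise E K" shows "connected_graph (N - K) E"
proof -
  have "clique N E (N \<inter> K)" using assms by (auto simp: clique_def pairwise_def)
  then have "connected_graph (N - N \<inter> K) E"
    using assms by (auto simp: prime_graph_def clique_separator_def)
  then show ?thesis by (simp add: Diff_Int)
qed

text \<open>Every edge leaving \<open>D\<close> inside \<open>U\<close> ends in the clique
  \<open>nbhd U D\<close>. Deleting this clique keeps \<open>N\<close> connected, so what is left of
  \<open>N\<close> cannot escape from \<open>D\<close>.\<close>

lemma prime_graph_subset_region:
  assumes "prime_graph N E" "N \<subseteq> U" "N \<inter> D \<noteq> {}" "pairwise E (nbhd U D)"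
  shows "N \<subseteq> D \<union> nbhd U D"
proof -
  have "N - nbhd U D \<subseteq> D"
    by (rule connected_graph_subset[OF prime_graph_diff_connected[OF assms(1,4)]])
      (use assms in \<open>auto simp: nbhd_def\<close>)
  then show ?thesis by blast
qed

section \<open>Induced paths\<close>

lemma induced_path_snoc:
  assumes "induced_path U E xs" "z \<in> U" "z \<notin> set xs"
    and "\<And>i. i < length xs \<Longrightarrow> E (xs ! i) z \<longleftrightarrow> Suc i = length xs"
  shows "induced_path U E (xs @ [z])"
  using assms by (auto simp: induced_path_def nth_append less_Suc_eq)

lemma induced_path_take:
  assumes "induced_path U E xs" "0 < n"
  shows "induced_path U E (take n xs)"
  using assms set_take_subset[of n xs] unfolding induced_path_def by auto

text \<open>Induction along a walk: when the walk moves on to \<open>z\<close>, the path built so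
  far is cut at its first vertex that equals \<open>z\<close> or is adjacent to it, and
  \<open>z\<close> is appended if it is not already the end.\<close>

lemma ex_induced_path:
  assumes "(adj_in W)\<^sup>*\<^sup>* x y" "x \<in> W"
  shows "\<exists>xs. induced_path W E xs \<and> hd xs = x \<and> last xs = y"
  using assms(1)
proof (induction rule: rtranclp_induct)
  case base
  have "induced_path W E [x]" using assms(2) by (simp add: induced_path_def)
  then show ?case by (intro exI[of _ "[x]"]) simp
next
  case (step y z)
  then obtain xs where xs: "induced_path W E xs" "hd xs = x" "last xs = y" by blast
  then have ne: "xs \<noteq> []" by (simp add: induced_path_def)
  define P where "P i \<longleftrightarrow> i < length xs \<and> (xs ! i = z \<or> E (xs ! i) z)" for i
  define k where "k = (LEAST i. P i)"
  have "P (length xs - 1)"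
    using step.hyps(2) ne xs(3) last_conv_nth[OF ne] by (simp add: P_def)
  then have k: "P k" unfolding k_def by (rule LeastI)
  have min: "\<not> P i" if "i < k" for i using that not_less_Least unfolding k_def by blast
  define ys where "ys = take (Suc k) xs"
  have len: "length ys = Suc k" using k by (simp add: ys_def P_def)
  have ys: "induced_path W E ys" unfolding ys_def using xs(1) by (rule induced_path_take) simp
  have hd: "hd ys = x" using xs(2) by (simp add: ys_def)
  have lst: "last ys = xs ! k"
    using len k by (subst last_conv_nth) (auto simp: ys_def P_def)
  show ?case
  proof (cases "xs ! k = z")
    case True
    then show ?thesis using ys hd lst by blast
  next
    case False
    then have "E (xs ! k) z" using k by (simp add: P_def)
    moreover have "xs ! i \<noteq> z \<and> \<not> E (xs ! i) z" if "i < k" for i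
      using min[OF that] that k by (auto simp: P_def)
    ultimately have "E (ys ! i) z \<longleftrightarrow> Suc i = length ys" and "ys ! i \<noteq> z" if "i < length ys" for i
      using that False len by (auto simp: ys_def less_Suc_eq)
    then have "induced_path W E (ys @ [z])"
      using ys step.hyps by (intro induced_path_snoc) (auto simp: in_set_conv_nth)
    then show ?thesis using hd len by (intro exI[of _ "ys @ [z]"]) (cases ys; auto)
  qed
qed

lemma induced_path_subset: "induced_path W E xs \<Longrightarrow> W \<subseteq> U \<Longrightarrow> induced_path U E xs"
  by (auto simp: induced_path_def)

section \<open>Convex sets and clique attachments\<close>

lemma monophonic_convex_Int:
  assumes "monophonic_convex U E C" "M \<subseteq> U"
  shows "monophonic_convex M E (M \<inter> C)"
  unfolding monophonic_convex_def
proof (intro conjI allI impI)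
  fix xs assume "induced_path M E xs \<and> hd xs \<in> M \<inter> C \<and> last xs \<in> M \<inter> C"
  then show "set xs \<subseteq> M \<inter> C"
    using assms induced_path_subset[of M xs U] by (auto simp: monophonic_convex_def induced_path_def)
qed auto

lemma monophonic_convex_trans:
  assumes "monophonic_convex U E C" "monophonic_convex V E U"
  shows "monophonic_convex V E C"
  unfolding monophonic_convex_def
proof (intro conjI allI impI)
  show "C \<subseteq> V" using assms by (auto simp: monophonic_convex_def)
  fix xs assume xs: "induced_path V E xs \<and> hd xs \<in> C \<and> last xs \<in> C"
  then have "set xs \<subseteq> U" using assms by (auto simp: monophonic_convex_def)
  then have "induced_path U E xs" using xs by (simp add: induced_path_def)
  then show "set xs \<subseteq> C" using xs assms(1) by (simp add: monophonic_convex_def)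
qed

text \<open>An induced path between two attachments through the component has its inner vertices
  outside \<open>C\<close>, while convexity puts the whole path into \<open>C\<close>. So it has no
  inner vertices and is a single edge.\<close>

lemma pairwise_nbhd_component:
  assumes conv: "monophonic_convex U E C" and u: "u \<in> U - C"
  shows "pairwise E (nbhd U (component (U - C) u))"
proof (rule pairwiseI)
  let ?A = "component (U - C) u"
  fix x y assume x: "x \<in> nbhd U ?A" and y: "y \<in> nbhd U ?A" and "x \<noteq> y"
  have A: "?A \<subseteq> U - C" by (rule component_subset[OF u])
  have C: "x \<in> C" "y \<in> C" using x y nbhd_component_subset[OF u] by auto
  obtain a b where ab: "a \<in> ?A" "E a x" "b \<in> ?A" "E b y" using x y by (auto simp: nbhd_def)
  \<comment> \<open>Working inside \<open>?W\<close> confines the induced path to the component and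
    the two endpoints.\<close>
  let ?W = "insert x (insert y ?A)"
  have "(adj_in ?A)\<^sup>*\<^sup>* a b" using adj_in_component[OF u] ab by blast
  then have "(adj_in ?W)\<^sup>*\<^sup>* a b" by (rule rtranclp_mono[THEN predicate2D, rotated]) auto
  then have "(adj_in ?W)\<^sup>*\<^sup>* x b"
    by (rule converse_rtranclp_into_rtranclp[rotated]) (use ab E_sym in auto)
  then have "(adj_in ?W)\<^sup>*\<^sup>* x y"
    by (rule rtranclp.rtrancl_into_rtrancl) (use ab in auto)
  then obtain xs where xs: "induced_path ?W E xs" "hd xs = x" "last xs = y"
    using ex_induced_path by blast
  have "?W \<subseteq> U" using A x y by (auto simp: nbhd_def)
  then have "set xs \<subseteq> C"
    using conv xs C induced_path_subset by (auto simp: monophonic_convex_def)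
  then have sub: "set xs \<subseteq> {x, y}" using xs(1) A by (auto simp: induced_path_def)
  have "distinct xs" "xs \<noteq> []" using xs(1) by (auto simp: induced_path_def)
  then have "length xs \<le> 2"
    using sub card_mono[of "{x, y}" "set xs"] \<open>x \<noteq> y\<close> by (simp add: distinct_card)
  moreover have "length xs \<noteq> 1" using xs \<open>x \<noteq> y\<close> by (auto simp: length_Suc_conv)
  ultimately have "length xs = 2" using \<open>xs \<noteq> []\<close> by (cases xs) (auto simp: le_Suc_eq)
  then have "xs ! 0 = x" "xs ! 1 = y" "1 < length xs"
    using xs \<open>xs \<noteq> []\<close> by (auto simp: hd_conv_nth last_conv_nth)
  moreover have "E (xs ! 0) (xs ! 1)"
    using xs(1) \<open>1 < length xs\<close> unfolding induced_path_def by auto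
  ultimately show "E x y" by simp
qed

text \<open>An induced path that leaves \<open>T\<close> and comes back does so at two distinct
  vertices of the clique \<open>nbhd U (U - T)\<close>; the edge between them is a chord.\<close>

lemma monophonic_convexI:
  assumes "T \<subseteq> U" "pairwise E (nbhd U (U - T))"
  shows "monophonic_convex U E T"
  unfolding monophonic_convex_def
proof (intro conjI allI impI)
  fix xs assume xs: "induced_path U E xs \<and> hd xs \<in> T \<and> last xs \<in> T"
  then have ne: "xs \<noteq> []" and adj: "\<And>i j. i < j \<Longrightarrow> j < length xs \<Longrightarrow> E (xs ! i) (xs ! j) \<longleftrightarrow> j = Suc i"
    and U: "\<And>i. i < length xs \<Longrightarrow> xs ! i \<in> U" and dist: "distinct xs"
    by (auto simp: induced_path_def)
  have T0: "xs ! 0 \<in> T" and Tl: "xs ! (length xs - 1) \<in> T"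
    using xs ne by (auto simp: hd_conv_nth last_conv_nth)
  have "xs ! k \<in> T" if k: "k < length xs" for k
  proof (rule ccontr)
    assume nT: "xs ! k \<notin> T"
    \<comment> \<open>\<open>i\<close> is the last index before \<open>k\<close>, and
      \<open>j\<close> the first after \<open>k\<close>, with a vertex in \<open>T\<close>. As
      \<open>i < k < j\<close>, an edge between these two vertices skips
      \<open>xs ! k\<close>.\<close>
    define i where "i = (GREATEST i. i < k \<and> xs ! i \<in> T)"
    have "0 < k" using nT T0 by (cases k) auto
    then have i: "i < k \<and> xs ! i \<in> T"
      unfolding i_def by (intro GreatestI_nat[of "\<lambda>i. i < k \<and> xs ! i \<in> T" 0 k]) (use T0 in auto)
    have imax: "m \<le> i" if "m < k" "xs ! m \<in> T" for m
      unfolding i_def by (rule Greatest_le_nat[of "\<lambda>i. i < k \<and> xs ! i \<in> T" m k]) (use that in auto)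
    let ?Q = "\<lambda>j. k < j \<and> j < length xs \<and> xs ! j \<in> T"
    define j where "j = (LEAST j. k < j \<and> j < length xs \<and> xs ! j \<in> T)"
    have "k \<noteq> length xs - 1" using nT Tl by auto
    then have j: "k < j \<and> j < length xs \<and> xs ! j \<in> T"
      unfolding j_def by (intro LeastI[of ?Q "length xs - 1"]) (use k Tl in auto)
    have jmin: "xs ! m \<notin> T" if "k < m" "m < j" for m
      using not_less_Least[of m ?Q, folded j_def] that j by auto
    have i1: "xs ! Suc i \<notin> T"
      using imax[of "Suc i"] i nT by (cases "Suc i = k") auto
    have j1: "xs ! (j - 1) \<notin> T"
    proof -
      have "j - 1 = k \<or> k < j - 1" "j - 1 < j" using j by linarith+
      then show ?thesis using jmin[of "j - 1"] nT by blast
    qed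
    have "E (xs ! i) (xs ! Suc i)" using adj i k by simp
    then have "xs ! i \<in> nbhd U (U - T)"
      using i i1 U[of i] U[of "Suc i"] k E_sym by (auto simp: nbhd_def)
    moreover have "E (xs ! (j - 1)) (xs ! j)" using adj[of "j - 1" j] j by simp
    then have "xs ! j \<in> nbhd U (U - T)"
      using j j1 U[of j] U[of "j - 1"] by (auto simp: nbhd_def)
    moreover have "xs ! i \<noteq> xs ! j" using dist i j by (simp add: nth_eq_iff_index_eq)
    ultimately have "E (xs ! i) (xs ! j)" using assms(2) by (auto simp: pairwise_def)
    then show False using adj[of i j] i j by simp
  qed
  then show "set xs \<subseteq> T" by (auto simp: in_set_conv_nth)
qed (rule assms)

text \<open>If \<open>M\<close> had a vertex outside \<open>C\<close>, its component in
  \<open>M - C\<close> would have a clique neighbourhood. Primality confines \<open>M\<close> to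
  that component and its neighbourhood, so \<open>x\<close> and \<open>y\<close> would both lie in
  the clique.\<close>

lemma prime_graph_subset_convex:
  assumes prime: "prime_graph M E" and "M \<subseteq> U" and conv: "monophonic_convex U E C"
    and "x \<in> M" "y \<in> M" "x \<in> C" "y \<in> C" "x \<noteq> y" "\<not> E x y"
  shows "M \<subseteq> C"
proof (rule ccontr)
  assume "\<not> M \<subseteq> C"
  then obtain w where w: "w \<in> M - M \<inter> C" by blast
  let ?A = "component (M - M \<inter> C) w"
  have K: "pairwise E (nbhd M ?A)"
    by (rule pairwise_nbhd_component[OF monophonic_convex_Int w]) fact+
  have "w \<in> ?A" by (rule component_self)
  then have "M \<subseteq> ?A \<union> nbhd M ?A"
    using prime_graph_subset_region[OF prime subset_refl _ K] w by blast
  moreover have "?A \<inter> C = {}" using component_subset[OF w] w by auto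
  ultimately have "x \<in> nbhd M ?A" "y \<in> nbhd M ?A" using assms by auto
  then show False using K \<open>x \<noteq> y\<close> \<open>\<not> E x y\<close> by (auto simp: pairwise_def)
qed

section \<open>Maximal prime subgraphs and petals\<close>

lemma ex_mp_subgraph:
  assumes "finite U" "N \<subseteq> U" "prime_graph N E"
  shows "\<exists>M. mp_subgraph U E M \<and> N \<subseteq> M"
proof -
  let ?F = "{M. N \<subseteq> M \<and> M \<subseteq> U \<and> prime_graph M E}"
  have "finite ?F" using assms(1) by (auto intro: finite_subset[of _ "Pow U"])
  moreover have "N \<in> ?F" using assms by auto
  ultimately obtain M where "M \<in> ?F" "\<forall>B\<in>?F. M \<subseteq> B \<longrightarrow> M = B"
    using finite_has_maximal[of ?F] by (metis (no_types, lifting) empty_iff)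
  then show ?thesis unfolding mp_subgraph_def by (intro exI[of _ M]) auto
qed

lemma ex_mp_subgraph_vertex:
  assumes "finite U" "v \<in> U" shows "\<exists>M. mp_subgraph U E M \<and> v \<in> M"
  using ex_mp_subgraph[of U "{v}"] assms prime_graph_pairwise[of "{v}"] by simp

lemma mp_subgraph_eq_if_interior:
  assumes "mp_subgraph U E N" "v \<in> N" "v \<in> mp_interior U E M"
  shows "N = M"
  using assms by (auto simp: mp_interior_def mp_boundary_def)

text \<open>The edge \<open>v w\<close> is a clique, hence prime, hence contained in some
  mp-subgraph; as \<open>v\<close> is interior to \<open>M\<close>, that one is
  \<open>M\<close>.\<close>

lemma mp_interior_adj:
  assumes "finite U" "v \<in> mp_interior U E M" "M \<subseteq> U" "w \<in> U" "E v w"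
  shows "w \<in> M"
proof -
  have "v \<in> U" using assms by (auto simp: mp_interior_def)
  moreover have "prime_graph {v, w} E"
    using assms E_sym by (intro prime_graph_pairwise) (auto simp: pairwise_def)
  ultimately obtain N where "mp_subgraph U E N" "{v, w} \<subseteq> N"
    using ex_mp_subgraph[of U "{v, w}"] assms by auto
  then show ?thesis using mp_subgraph_eq_if_interior assms(2) by blast
qed

text \<open>After deletion of a clique \<open>Q\<close>, two vertices in different components would
  both have components meeting the clique \<open>nbhd U D\<close>, which joins these
  components.\<close>

lemma minimal_region_prime:
  assumes "D \<subseteq> U" "pairwise E (nbhd U D)"
    and min: "\<And>B. B \<subseteq> D \<Longrightarrow> B \<noteq> {} \<Longrightarrow> pairwise E (nbhd U B) \<Longrightarrow> B = D"
  shows "prime_graph (D \<union> nbhd U D) E"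
proof -
  let ?K = "nbhd U D" and ?M = "D \<union> nbhd U D"
  have conn: "connected_graph (?M - Q) E" if Q: "pairwise E Q" for Q
  proof -
    let ?W = "?M - Q"
    have meets: "\<exists>z. z \<in> component ?W x \<and> z \<in> ?K"
      if x: "x \<in> ?W" and y: "y \<in> ?W" and nxy: "y \<notin> component ?W x" for x y
    proof (rule ccontr)
      let ?B = "component ?W x"
      assume no: "\<nexists>z. z \<in> ?B \<and> z \<in> ?K"
      have BW: "?B \<subseteq> ?W" by (rule component_subset[OF x])
      then have BD: "?B \<subseteq> D" using no by blast
      have "nbhd U ?B \<subseteq> Q"
      proof
        fix y assume y: "y \<in> nbhd U ?B"
        then have "y \<in> ?M" using nbhd_mono[OF BD assms(1)] by blast
        then show "y \<in> Q" using y component_closed[OF x] unfolding nbhd_def by blast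
      qed
      moreover from this have "pairwise E (nbhd U ?B)" using Q pairwise_subset by blast
      then have "?B = D" using min[OF BD] component_self by blast
      \<comment> \<open>With \<open>?B = D\<close>, the whole of \<open>nbhd U D\<close> lies in
        \<open>Q\<close>, so \<open>?W\<close> is contained in \<open>?B\<close>, and no room is
        left for \<open>y\<close>.\<close>
      ultimately show False using nxy y by auto
    qed
    show ?thesis unfolding connected_graph_def
    proof (intro ballI)
      fix x y assume x: "x \<in> ?W" and y: "y \<in> ?W"
      show "(adj_in ?W)\<^sup>*\<^sup>* x y"
      proof (rule ccontr)
        assume n: "\<not> (adj_in ?W)\<^sup>*\<^sup>* x y"
        then have "y \<notin> component ?W x" "x \<notin> component ?W y"
          using adj_in_sym[of ?W y x] unfolding component_def by blast+
        then obtain a b where a: "a \<in> component ?W x" "a \<in> ?K" and b: "b \<in> component ?W y" "b \<in> ?K"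
          using meets x y by meson
        have "a \<in> ?W" "b \<in> ?W" using subsetD[OF component_subset[OF x] a(1)] subsetD[OF component_subset[OF y] b(1)] .
        then have "b \<in> component ?W x"
          using a b component_closed[OF x a(1), of b] pairwiseD[OF assms(2) a(2) b(2)]
          by (cases "a = b") simp_all
        then have "(adj_in ?W)\<^sup>*\<^sup>* x b" "(adj_in ?W)\<^sup>*\<^sup>* b y"
          using b(1) adj_in_sym unfolding component_def by blast+
        then have "(adj_in ?W)\<^sup>*\<^sup>* x y" by (rule rtranclp_trans)
        with n show False ..
      qed
    qed
  qed
  have "connected_graph ?M E" using conn[of "{}"] by simp
  with conn show ?thesis unfolding prime_graph_def clique_separator_def clique_def by blast
qed

text \<open>Choose \<open>D\<close> inclusion-minimal. A prime subgraph meeting \<open>D\<close>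
  stays inside \<open>D\<close> and its neighbourhood, so their union is the only mp-subgraph
  meeting \<open>D\<close>, and its boundary lies in the clique \<open>nbhd U D\<close>.\<close>

lemma ex_petal_in_region:
  assumes "finite U" "D\<^sub>0 \<noteq> {}" "D\<^sub>0 \<subseteq> U" "pairwise E (nbhd U D\<^sub>0)"
  shows "\<exists>D. D \<noteq> {} \<and> D \<subseteq> D\<^sub>0 \<and> pairwise E (nbhd U D) \<and> petal U E (D \<union> nbhd U D)"
proof -
  let ?F = "{D. D \<noteq> {} \<and> D \<subseteq> D\<^sub>0 \<and> pairwise E (nbhd U D)}"
  have "finite ?F" using assms by (auto intro: finite_subset[of _ "Pow U"])
  moreover have "D\<^sub>0 \<in> ?F" using assms by auto
  ultimately obtain D where D: "D \<in> ?F" and "\<forall>B\<in>?F. B \<subseteq> D \<longrightarrow> D = B"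
    using finite_has_minimal[of ?F] by (metis (no_types, lifting) empty_iff)
  then have min: "B = D" if "B \<in> ?F" "B \<subseteq> D" for B using that by metis
  let ?M = "D \<union> nbhd U D"
  have DU: "D \<subseteq> U" and K: "pairwise E (nbhd U D)" using D assms by auto
  have prime: "prime_graph ?M E"
    by (rule minimal_region_prime[OF DU K]) (use D min in auto)
  have MU: "?M \<subseteq> U" using DU by (auto simp: nbhd_def)
  have sub: "N \<subseteq> ?M" if "prime_graph N E" "N \<subseteq> U" "N \<inter> D \<noteq> {}" for N
    by (rule prime_graph_subset_region[OF that K])
  have mp: "mp_subgraph U E ?M"
    unfolding mp_subgraph_def
  proof (intro conjI allI impI MU prime)
    fix N assume N: "?M \<subseteq> N \<and> N \<subseteq> U \<and> prime_graph N E"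
    then show "N = ?M" using sub[of N] D by blast
  qed
  have "N = ?M" if "mp_subgraph U E N" "N \<inter> D \<noteq> {}" for N
    using that sub[of N] MU prime unfolding mp_subgraph_def by blast
  then have int: "D \<subseteq> mp_interior U E ?M"
    unfolding mp_interior_def mp_boundary_def by blast
  then have "mp_boundary U E ?M \<subseteq> nbhd U D" by (auto simp: mp_interior_def mp_boundary_def)
  then have "clique U E (mp_boundary U E ?M)"
    using pairwise_subset[OF K] MU by (auto simp: clique_def mp_boundary_def)
  then have "petal U E ?M" using mp int D by (auto simp: petal_def)
  then show ?thesis using D K by blast
qed

text \<open>Otherwise each petal near the component \<open>?A\<close> of \<open>w\<close> has an
  interior vertex in the clique \<open>?K\<close>. Unless a first petal covers \<open>?A\<close> and
  has \<open>w\<close> in its interior, a second one is found in the rest of \<open>?A\<close>; both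
  contain the same interior vertex of the first, which is impossible.\<close>

lemma ex_petal_outside_convex:
  assumes fin: "finite U" and conv: "monophonic_convex U E C" and w: "w \<in> U - C"
  shows "\<exists>P. petal U E P \<and> (w \<in> mp_interior U E P \<or> mp_interior U E P \<inter> C = {})"
proof (rule ccontr)
  assume contra: "\<not> ?thesis"
  let ?A = "component (U - C) w"
  let ?K = "nbhd U ?A"
  have K: "pairwise E ?K" by (rule pairwise_nbhd_component[OF conv w])
  have A: "?A \<subseteq> U - C" "w \<in> ?A" using component_subset[OF w] component_self by auto
  have meets_C: "?K \<subseteq> P \<and> (\<exists>s. s \<in> ?K \<and> s \<in> mp_interior U E P)"
    if P: "petal U E P" "P \<subseteq> ?A \<union> ?K" for P
  proof -
    obtain s where s: "s \<in> mp_interior U E P" "s \<in> C" using contra P by blast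
    then have sK: "s \<in> ?K" using P A by (auto simp: mp_interior_def)
    have "k \<in> P" if "k \<in> ?K" for k
    proof (cases "k = s")
      case True then show ?thesis using s by (simp add: mp_interior_def)
    next
      case False
      then have "E s k" using that sK K by (auto simp: pairwise_def)
      moreover have "P \<subseteq> U" using P by (simp add: petal_def mp_subgraph_def)
      ultimately show ?thesis using mp_interior_adj[OF fin s(1)] that by (simp add: nbhd_def)
    qed
    then show ?thesis using s sK by blast
  qed
  have AU: "?A \<subseteq> U" using A by blast
  obtain D where D: "D \<noteq> {}" "D \<subseteq> ?A" "petal U E (D \<union> nbhd U D)" "pairwise E (nbhd U D)"
    using ex_petal_in_region[OF fin _ AU K] A by blast
  define M where "M = D \<union> nbhd U D"
  have M: "petal U E M" "M \<subseteq> ?A \<union> ?K" using D nbhd_mono[OF D(2) AU] by (auto simp: M_def)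
  then have mpM: "mp_subgraph U E M" by (simp add: petal_def)
  have KM: "?K \<subseteq> M" and "\<exists>s. s \<in> ?K \<and> s \<in> mp_interior U E M" using meets_C[OF M] by auto
  then obtain s where s: "s \<in> ?K" "s \<in> mp_interior U E M" by blast
  have "\<not> ?A \<subseteq> M"
  proof
    assume AM: "?A \<subseteq> M"
    have "N = M" if N: "mp_subgraph U E N" "w \<in> N" for N
    proof -
      have "N \<subseteq> ?A \<union> ?K"
        using N A by (intro prime_graph_subset_region[OF _ _ _ K]) (auto simp: mp_subgraph_def)
      then have "N \<subseteq> M" using AM KM by blast
      then show ?thesis using N(1) mpM by (auto simp: mp_subgraph_def)
    qed
    then have "w \<in> mp_interior U E M" using AM A by (auto simp: mp_interior_def mp_boundary_def)
    then show False using contra M by blast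
  qed
  \<comment> \<open>An edge leaving \<open>?A - M\<close> ends in \<open>M\<close>, since
    \<open>?K \<subseteq> M\<close>. It cannot end in \<open>D\<close>, because all neighbours of
    \<open>D\<close> lie in \<open>M\<close>.\<close>
  moreover have "nbhd U (?A - M) \<subseteq> nbhd U D"
  proof
    fix y assume "y \<in> nbhd U (?A - M)"
    then obtain x where y: "y \<in> U" "y \<notin> ?A - M" and x: "x \<in> ?A" "x \<notin> M" "E x y"
      by (auto simp: nbhd_def)
    then have "y \<in> M" using KM by (auto simp: nbhd_def)
    moreover have "y \<notin> D" using x AU E_sym by (auto simp: M_def nbhd_def)
    ultimately show "y \<in> nbhd U D" by (simp add: M_def)
  qed
  then have "pairwise E (nbhd U (?A - M))"
    using D(4) by (rule pairwise_subset[rotated])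
  ultimately obtain D' where D': "D' \<noteq> {}" "D' \<subseteq> ?A - M" "petal U E (D' \<union> nbhd U D')"
    using ex_petal_in_region[OF fin, of "?A - M"] AU by blast
  have "D' \<union> nbhd U D' \<subseteq> ?A \<union> ?K" using D' by (intro nbhd_mono AU) auto
  then have "s \<in> D' \<union> nbhd U D'" using meets_C[OF D'(3)] s by blast
  then have "D' \<union> nbhd U D' = M"
    using mp_subgraph_eq_if_interior s(2) D'(3) unfolding petal_def by blast
  then show False using D' by blast
qed

text \<open>The omitted vertices are interior to \<open>M\<close>, so their neighbours stay in
  \<open>M\<close> and the attachment lies in the boundary together with \<open>Y\<close>. The case
  \<open>Y = {}\<close> serves flower subgraphs, the general one stamen sets.\<close>

lemma monophonic_convex_stamen:
  assumes fin: "finite U" and M: "mp_subgraph U E M" and Y: "Y \<subseteq> mp_interior U E M"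
    and cl: "pairwise E (mp_boundary U E M \<union> Y)"
  shows "monophonic_convex U E (U - mp_interior U E M \<union> Y)"
proof (rule monophonic_convexI)
  have MU: "M \<subseteq> U" using M by (simp add: mp_subgraph_def)
  then have IU: "mp_interior U E M \<subseteq> U" by (auto simp: mp_interior_def)
  then show "U - mp_interior U E M \<union> Y \<subseteq> U" using Y by auto
  have "nbhd U (U - (U - mp_interior U E M \<union> Y)) \<subseteq> mp_boundary U E M \<union> Y"
  proof
    fix y assume "y \<in> nbhd U (U - (U - mp_interior U E M \<union> Y))"
    then obtain x where y: "y \<in> U" "y \<notin> mp_interior U E M - Y"
      and x: "x \<in> mp_interior U E M" "E x y" by (auto simp: nbhd_def)
    then have "y \<in> M" using mp_interior_adj[OF fin x(1) MU] by blast
    then show "y \<in> mp_boundary U E M \<union> Y" using y by (auto simp: mp_interior_def)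
  qed
  then show "pairwise E (nbhd U (U - (U - mp_interior U E M \<union> Y)))"
    using cl pairwise_subset by blast
qed

section \<open>Flower subgraphs and stamen sets\<close>

lemma flower_subgraph_subset: "flower_subgraph V E U \<Longrightarrow> U \<subseteq> V"
  by (induction rule: flower_subgraph.induct) auto

lemma monophonic_convex_flower:
  assumes "flower_subgraph V E U" "finite V" shows "monophonic_convex V E U"
  using assms(1)
proof (induction rule: flower_subgraph.induct)
  case self
  show ?case by (rule monophonic_convex_self)
next
  case (remove_petal U M)
  have "finite U" using remove_petal flower_subgraph_subset assms(2) finite_subset by blast
  then have "monophonic_convex U E (U - mp_interior U E M)"
    using monophonic_convex_stamen[of U M "{}"] remove_petal by (auto simp: petal_def clique_def)
  then show ?case using remove_petal monophonic_convex_trans by blast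
qed

text \<open>Removing a petal interior free of \<open>S\<close> would leave a smaller flower
  subgraph. It is convex and contains \<open>S\<close>, so it contains the hull, against
  minimality.\<close>

lemma minimum_flower_petal_meets:
  assumes "finite V" "minimum_flower V E S H" "petal H E M"
  shows "S \<inter> mp_interior H E M \<noteq> {}"
proof
  assume disj: "S \<inter> mp_interior H E M = {}"
  let ?H' = "H - mp_interior H E M"
  have fl: "flower_subgraph V E H" and hull: "monophonic_hull V E S \<subseteq> H"
    using assms(2) by (auto simp: minimum_flower_def)
  then have fl': "flower_subgraph V E ?H'" using assms(3) by (auto intro: flower_subgraph.intros)
  have "S \<subseteq> H" using hull hull_subset[of S "monophonic_convex V E"]
    by (auto simp: monophonic_hull_def)
  then have "monophonic_hull V E S \<subseteq> ?H'"
    unfolding monophonic_hull_def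
    using disj by (intro hull_minimal monophonic_convex_flower[OF fl' assms(1)]) auto
  then have "card H \<le> card ?H'" using assms(2) fl' by (auto simp: minimum_flower_def)
  moreover have "?H' \<subset> H"
    using assms(3) by (auto simp: petal_def mp_subgraph_def mp_interior_def)
  moreover have "finite H" using fl flower_subgraph_subset assms(1) finite_subset by blast
  ultimately show False using psubset_card_mono by (metis not_le)
qed

text \<open>Dropping one vertex leaves nothing in Type 1 and removes the only possible nonedge,
  \<open>u1 u2\<close>, in Type 2.\<close>

lemma stamen_set_pairwise:
  assumes "petal U E M" "stamen_set U E M X" "v \<in> X"
  shows "pairwise E (mp_boundary U E M \<union> (X - {v}))"
proof -
  let ?B = "mp_boundary U E M"
  have B: "pairwise E ?B" using assms(1) by (simp add: petal_def clique_def)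
  consider "card X = 1" | u1 u2 where "X = {u1, u2}" "\<forall>w\<in>?B. E w u1 \<and> E w u2"
    | "pairwise E (X \<union> ?B)"
    using assms(2) by (auto simp: stamen_set_def clique_def)
  then show ?thesis
  proof cases
    case 1
    then have "X = {v}" using assms(3) by (auto simp: card_1_singleton_iff)
    then show ?thesis using B by simp
  next
    case 2
    then show ?thesis using B E_sym assms(3) unfolding pairwise_def by blast
  next
    case 3
    then show ?thesis by (rule pairwise_subset) auto
  qed
qed

end

section \<open>Independence in terms of stamen sets of a minimum flower\<close>

theorem theorem2:
  fixes V :: "'a set" and E :: "'a \<Rightarrow> 'a \<Rightarrow> bool" and S H :: "'a set"
  assumes "simple_graph V E" and "connected_graph V E"
    and "S \<subseteq> V"
    and "minimum_flower V E S H"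
  shows "convexly_independent V E S \<longleftrightarrow>
    (\<forall>M. mp_subgraph H E M \<longrightarrow>
       (if petal H E M then \<exists>X. stamen_set H E M X \<and> S \<inter> M \<subseteq> X else S \<inter> M = {}))"
    (is "?indep \<longleftrightarrow> ?stamens")
proof -
  interpret adjacency E using assms(1) by unfold_locales (auto simp: simple_graph_def)
  have finV: "finite V" using assms(1) by (simp add: simple_graph_def)
  have fl: "flower_subgraph V E H" and hullH: "monophonic_hull V E S \<subseteq> H"
    using assms(4) by (auto simp: minimum_flower_def)
  have HV: "H \<subseteq> V" by (rule flower_subgraph_subset[OF fl])
  have finH: "finite H" using HV finV finite_subset by blast
  have convH: "monophonic_convex V E H" by (rule monophonic_convex_flower[OF fl finV])
  have sub_hull: "T \<subseteq> monophonic_hull V E T" for T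
    by (simp add: monophonic_hull_def hull_subset)
  have SH: "S \<subseteq> H" using hullH sub_hull by blast
  note meets = minimum_flower_petal_meets[OF finV assms(4)]
  show ?thesis
  proof
    assume ind: ?indep
    define C where "C v = monophonic_hull V E (S - {v})" for v
    have convC: "monophonic_convex V E (C v)" for v
      unfolding C_def using assms(3) by (intro monophonic_convex_hull) auto
    have SC: "S - {v} \<subseteq> C v" for v unfolding C_def by (rule sub_hull)
    have notC: "v \<notin> C v" if "v \<in> S" for v
      using ind that by (auto simp: C_def convexly_independent_def)
    \<comment> \<open>A petal interior that misses \<open>C v\<close> misses \<open>S - {v}\<close>,
      but it meets \<open>S\<close> by minimality of \<open>H\<close>; so it meets \<open>S\<close>
      in \<open>v\<close> alone.\<close>
    have ex_petal: "\<exists>P. petal H E P \<and> (w \<in> mp_interior H E P \<or> S \<inter> mp_interior H E P = {v})"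
      if w: "w \<in> H" "w \<notin> C v" for v w
    proof -
      have "monophonic_convex H E (H \<inter> C v)" by (rule monophonic_convex_Int[OF convC HV])
      then obtain P where P: "petal H E P"
          "w \<in> mp_interior H E P \<or> mp_interior H E P \<inter> (H \<inter> C v) = {}"
        using ex_petal_outside_convex[OF finH, of "H \<inter> C v" w] w by blast
      moreover have "S \<inter> mp_interior H E P = {v}" if "mp_interior H E P \<inter> (H \<inter> C v) = {}"
        using that meets[OF P(1)] SC[of v] SH by blast
      ultimately show ?thesis by blast
    qed
    have in_petal: "\<exists>P. petal H E P \<and> v \<in> mp_interior H E P" if "v \<in> S" for v
      using ex_petal[of v v] notC[OF that] SH that by blast
    show ?stamens
    proof (intro allI impI)
      fix M assume mp: "mp_subgraph H E M"
      have petal_eq: "petal H E M \<and> v \<in> mp_interior H E M" if "v \<in> S \<inter> M" for v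
        using in_petal[of v] that mp_subgraph_eq_if_interior[OF mp, of v] by auto
      show "if petal H E M then \<exists>X. stamen_set H E M X \<and> S \<inter> M \<subseteq> X else S \<inter> M = {}"
      proof (cases "petal H E M")
        case True
        let ?X = "S \<inter> M" and ?B = "mp_boundary H E M"
        have MH: "M \<subseteq> H" and prime: "prime_graph M E" using mp by (auto simp: mp_subgraph_def)
        have XI: "?X \<subseteq> mp_interior H E M" using petal_eq by blast
        have Xne: "?X \<noteq> {}" using meets[OF True] by (auto simp: mp_interior_def)
        have finX: "finite ?X" using MH finH finite_subset by blast
        have BM: "?B \<subseteq> M" by (auto simp: mp_boundary_def)
        \<comment> \<open>Otherwise the prime \<open>M\<close> would lie in \<open>C u\<close>,
          although \<open>u\<close> belongs to \<open>M\<close>.\<close>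
        have span: "\<not> (x \<in> C u \<and> y \<in> C u \<and> x \<noteq> y \<and> \<not> E x y)" if "u \<in> ?X" "x \<in> M" "y \<in> M" for u x y
          using prime_graph_subset_convex[OF prime _ convC, of x y u] MH HV that notC by blast
        \<comment> \<open>The boundary vertex \<open>w\<close> is in no petal interior. If it were
          outside \<open>C u\<close>, some petal would have \<open>u\<close> as its only interior
          vertex from \<open>S\<close>; that petal is \<open>M\<close>, which also has
          \<open>x\<close>. So \<open>w\<close> and \<open>x\<close> both lie in \<open>C u\<close>,
          and \<open>span\<close> makes them adjacent.\<close>
        have B_adj: "E w x" if x: "x \<in> ?X" and w: "w \<in> ?B" and card: "card ?X \<noteq> 1" for x w
        proof -
          obtain u where u: "u \<in> ?X" "u \<noteq> x"
            using card x by (metis is_singletonI' is_singleton_altdef empty_iff)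
          have wI: "w \<notin> mp_interior H E P" if "petal H E P" for P
            using that w BM mp mp_subgraph_eq_if_interior[OF mp, of w P] by (auto simp: mp_interior_def)
          have "w \<in> C u"
          proof (rule ccontr)
            assume "w \<notin> C u"
            then obtain P where P: "petal H E P" "S \<inter> mp_interior H E P = {u}"
              using ex_petal[of w u] wI w BM MH by blast
            then have "M = P" using mp_subgraph_eq_if_interior[OF mp, of u P] u by blast
            then have "S \<inter> mp_interior H E M = {u}" using P(2) by simp
            then have "x \<in> {u}" using x XI by blast
            then show False using u(2) by simp
          qed
          moreover have "x \<in> C u" using SC[of u] x u by blast
          moreover have "w \<noteq> x" using w x XI by (auto simp: mp_interior_def)
          ultimately show ?thesis using span[OF u(1), of w x] x w BM by blast
        qed
        have "stamen_set H E M ?X"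
        proof (cases "card ?X = 1")
          case True
          then show ?thesis using XI by (simp add: stamen_set_def)
        next
          case False
          then have card2: "card ?X \<ge> 2"
            using Xne finX card_gt_0_iff[of ?X] by linarith
          show ?thesis
          proof (cases "pairwise E ?X")
            case True
            have "pairwise E ?B" using \<open>petal H E M\<close> by (simp add: petal_def clique_def)
            then have "pairwise E (?X \<union> ?B)"
              using True B_adj[OF _ _ False] E_sym unfolding pairwise_def by blast
            then have "clique H E (?X \<union> ?B)" using BM MH by (auto simp: clique_def)
            then show ?thesis using XI card2 by (simp add: stamen_set_def)
          next
            case nonclique: False
            then obtain u1 u2 where u: "u1 \<in> ?X" "u2 \<in> ?X" "u1 \<noteq> u2" "\<not> E u1 u2"
              by (auto simp: pairwise_def)
            \<comment> \<open>A third vertex \<open>x\<close> would leave the nonadjacent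
              \<open>u1\<close> and \<open>u2\<close> in \<open>C x\<close>, against
              \<open>span\<close>.\<close>
            have "x \<in> {u1, u2}" if "x \<in> ?X" for x
              using span[OF that, of u1 u2] u SC[of x] by blast
            then have "?X = {u1, u2}" using u by blast
            moreover have "\<forall>w\<in>?B. E w u1 \<and> E w u2" using B_adj[OF _ _ False] u by blast
            ultimately show ?thesis using XI unfolding stamen_set_def by blast
          qed
        qed
        then show ?thesis using True by auto
      next
        case False
        then show ?thesis using petal_eq by auto
      qed
    qed
  next
    assume st: ?stamens
    show ?indep unfolding convexly_independent_def
    proof
      fix v assume v: "v \<in> S"
      obtain M where M: "mp_subgraph H E M" "v \<in> M"
        using ex_mp_subgraph_vertex[OF finH] v SH by blast
      then have pet: "petal H E M" using st v by (metis IntI empty_iff)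
      then obtain X where X: "stamen_set H E M X" "S \<inter> M \<subseteq> X" using st M by metis
      \<comment> \<open>\<open>?T\<close> is a convex set that contains \<open>S - {v}\<close> and
        omits \<open>v\<close>, so it separates \<open>v\<close> from the hull.\<close>
      let ?T = "H - mp_interior H E M \<union> (X - {v})"
      have XI: "X \<subseteq> mp_interior H E M" using X by (simp add: stamen_set_def)
      have vX: "v \<in> X" using X v M by blast
      have "monophonic_convex H E ?T"
        using XI stamen_set_pairwise[OF pet X(1) vX] by (intro monophonic_convex_stamen finH M) auto
      then have "monophonic_convex V E ?T" using convH monophonic_convex_trans by blast
      moreover have "S - {v} \<subseteq> ?T" using SH X by (auto simp: mp_interior_def)
      ultimately have "monophonic_hull V E (S - {v}) \<subseteq> ?T"
        unfolding monophonic_hull_def by (intro hull_minimal)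
      then show "v \<notin> monophonic_hull V E (S - {v})" using vX XI by blast
    qed
  qed
qed

end
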